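(* Let $\{\mathcal{S}_{\boldsymbol{\alpha}^{(k)}}\mid k\in\mathbb{N}\}$ be subdivision operators with finitely supported real masks $\boldsymbol{\alpha}^{(k)}$. Let $\mathcal{S}_{\boldsymbol{\alpha}}$ be a stationary subdivision operator (with a finitely supported real mask $\boldsymbol{\alpha}$) which is power bounded, that is, $$C_{\boldsymbol{\alpha}}:=\sup_{n\ge0}\|\mathcal{S}_{\boldsymbol{\alpha}}^{\,n}\|_\infty<\infty,$$ and suppose that $$\sum_{k=1}^{\infty}\big\|\mathcal{S}_{\boldsymbol{\alpha}^{(k)}}-\mathcal{S}_{\boldsymbol{\alpha}}\big\|_\infty<\infty.$$ For $J\ge1$ let $L_J=\max\big\{1,\ \max_{1\le p\le q\le J}\|\mathcal{S}_{\boldsymbol{\alpha}^{(q)}}\mathcal{S}_{\boldsymbol{\alpha}^{(q-1)}}\cdots\mathcal{S}_{\boldsymbol{\alpha}^{(p)}}\|_\infty\big\}$. Then $L:=\sup_{J\ge1}L_J<\infty$, and $$L\le C_{\boldsymbol{\alpha}}\exp\Big(C_{\boldsymbol{\alpha}}\sum_{k=1}^{\infty}\big\|\mathcal{S}_{\boldsymbol{\alpha}^{(k)}}-\mathcal{S}_{\boldsymbol{\alpha}}\big\|_\infty\Big).$$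
   Context: Sequences are real-valued and bi-infinite (indexed by $\mathbb{Z}$). For a finitely supported sequence (mask) $\boldsymbol{\alpha}$, the subdivision operator is $(\mathcal{S}_{\boldsymbol{\alpha}}\boldsymbol{c})_j=\sum_{i\in\mathbb{Z}}\alpha_{j-2i}c_i$, $j\in\mathbb{Z}$. $\mathbb{N}=\{1,2,\dots\}$. $\|\boldsymbol{c}\|_\infty=\sup_j|c_j|$, and for linear operators $\|\cdot\|_\infty$ is the operator norm induced on bounded sequences, $\|\mathcal{T}\|_\infty=\sup_{\|\boldsymbol{c}\|_\infty\le1}\|\mathcal{T}\boldsymbol{c}\|_\infty$. $\mathcal{S}_{\boldsymbol{\alpha}}^{\,0}$ is the identity operator. *)

theory Defs
  imports "HOL-Analysis.Analysis"
begin

type_synonym bisequence = "int \<Rightarrow> real"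

definition finitely_supported :: "bisequence \<Rightarrow> bool" where
  "finitely_supported a \<longleftrightarrow> finite {i. a i \<noteq> 0}"

text \<open>For a finitely supported mask only finitely many terms of the sum are nonzero, so it
  converges for every sequence \<open>c\<close>, bounded or not.\<close>

definition subdivision :: "bisequence \<Rightarrow> bisequence \<Rightarrow> bisequence" where
  "subdivision a c = (\<lambda>j. \<Sum>\<^sub>\<infinity>i\<in>UNIV. a (j - 2 * i) * c i)"

text \<open>Norms take values in \<open>[0, \<infinity>]\<close>, so that every supremum and series of norms below is meaningful
  without side conditions, and ``finite'' is literally \<open>< \<infinity>\<close>. Bounded sequences are those with
  \<open>sup_norm c < \<infinity>\<close>.\<close>

definition sup_norm :: "bisequence \<Rightarrow> ennreal" where
  "sup_norm c = (SUP j. ennreal \<bar>c j\<bar>)"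

definition op_norm :: "(bisequence \<Rightarrow> bisequence) \<Rightarrow> ennreal" where
  "op_norm T = (SUP c\<in>{c. sup_norm c \<le> 1}. sup_norm (T c))"

definition op_diff ::
  "(bisequence \<Rightarrow> bisequence) \<Rightarrow> (bisequence \<Rightarrow> bisequence) \<Rightarrow> bisequence \<Rightarrow> bisequence" where
  "op_diff T U = (\<lambda>c j. T c j - U c j)"

definition power_bound :: "bisequence \<Rightarrow> ennreal" where
  "power_bound a = (SUP n::nat. op_norm (subdivision a ^^ n))"

text \<open>The masks \<open>A k\<close> are indexed by \<open>k \<ge> 1\<close>; the value \<open>A 0\<close> is never used.\<close>

definition total_deviation :: "(nat \<Rightarrow> bisequence) \<Rightarrow> bisequence \<Rightarrow> ennreal" where
  "total_deviation A a = (\<Sum>k. op_norm (op_diff (subdivision (A (Suc k))) (subdivision a)))"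

text \<open>The composition \<open>S\<^sub>q \<circ> S\<^sub>q\<^sub>-\<^sub>1 \<circ> \<dots> \<circ> S\<^sub>p\<close> with \<open>S\<^sub>k = subdivision (A k)\<close> and \<open>p \<le> q\<close>: the
  operator with the lowest index is applied first.\<close>

definition subdivision_product :: "(nat \<Rightarrow> bisequence) \<Rightarrow> nat \<Rightarrow> nat \<Rightarrow> bisequence \<Rightarrow> bisequence" where
  "subdivision_product A q p = fold (\<lambda>k T. subdivision (A k) \<circ> T) [p..<Suc q] id"

definition product_bound :: "(nat \<Rightarrow> bisequence) \<Rightarrow> nat \<Rightarrow> ennreal" where
  "product_bound A J =
     max 1 (Max {op_norm (subdivision_product A q p) | p q. 1 \<le> p \<and> p \<le> q \<and> q \<le> J})"

lemma subdivision_product_same: "subdivision_product A p p = subdivision (A p)"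
  by (simp add: subdivision_product_def)

lemma subdivision_product_Suc:
  "p \<le> Suc q \<Longrightarrow>
    subdivision_product A (Suc q) p = subdivision (A (Suc q)) \<circ> subdivision_product A q p"
  by (simp add: subdivision_product_def)

lemma subdivision_eq_finite_sum:
  assumes "finitely_supported a"
  shows "finite {i. a (j - 2 * i) \<noteq> 0}"
    and "subdivision a c j = (\<Sum>i | a (j - 2 * i) \<noteq> 0. a (j - 2 * i) * c i)"
proof -
  have "finite ((\<lambda>i. j - 2 * i) -` {i. a i \<noteq> 0})"
    using assms unfolding finitely_supported_def by (intro finite_vimageI) (auto intro: injI)
  then show fin: "finite {i. a (j - 2 * i) \<noteq> 0}"
    by (simp add: vimage_def)
  have "subdivision a c j = (\<Sum>\<^sub>\<infinity>i\<in>{i. a (j - 2 * i) \<noteq> 0}. a (j - 2 * i) * c i)"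
    unfolding subdivision_def by (rule infsum_cong_neutral) auto
  with fin show "subdivision a c j = (\<Sum>i | a (j - 2 * i) \<noteq> 0. a (j - 2 * i) * c i)"
    by simp
qed

end

theory Submission
  imports Defs
begin

text \<open>
  Write \<open>S\<close> for the stationary operator, \<open>S\<^sub>k = S + D\<^sub>k\<close> for the perturbed ones, and \<open>C\<close> for the
  power bound of \<open>S\<close>. Expanding a product of the \<open>S\<^sub>k\<close> naively and estimating every factor \<open>S\<close>
  separately would produce powers of the norm of \<open>S\<close>, which need not be bounded. The remedy is
  to measure an operator \<open>T\<close> by the larger quantity \<open>sup\<^sub>n \<parallel>S\<^sup>n T\<parallel>\<close>, which left
  composition with \<open>S\<close> cannot increase. With \<open>P\<^sub>q = S\<^sub>q \<dots> S\<^sub>p\<close>, linearity of \<open>S\<^sup>n\<close> gives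
  \<open>S\<^sup>n P\<^sub>q\<^sub>+\<^sub>1 = S\<^sup>n\<^sup>+\<^sup>1 P\<^sub>q + S\<^sup>n D\<^sub>q\<^sub>+\<^sub>1 P\<^sub>q\<close>, so if \<open>B\<close> bounds \<open>\<parallel>S\<^sup>n P\<^sub>q\<parallel>\<close> for every \<open>n\<close>, then \<open>B (1 + C \<parallel>D\<^sub>q\<^sub>+\<^sub>1\<parallel>) \<le> B exp (C \<parallel>D\<^sub>q\<^sub>+\<^sub>1\<parallel>)\<close>
  bounds \<open>\<parallel>S\<^sup>n P\<^sub>q\<^sub>+\<^sub>1\<parallel>\<close> for every \<open>n\<close>. Starting from the empty product, for which \<open>B = C\<close> works,
  induction on \<open>q\<close> gives the exponential bound; this is
  \<open>op_norm_power_subdivision_product_le\<close>. The maximum with \<open>1\<close> is harmless because the identity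
  is a power of \<open>S\<close>, whence \<open>C \<ge> 1\<close>.
\<close>

definition linear_operator :: "(bisequence \<Rightarrow> bisequence) \<Rightarrow> bool" where
  "linear_operator T \<longleftrightarrow>
     (\<forall>c d. T (\<lambda>j. c j + d j) = (\<lambda>j. T c j + T d j)) \<and>
     (\<forall>r c. T (\<lambda>j. r * c j) = (\<lambda>j. r * T c j))"

lemma linear_operator_add:
  "linear_operator T \<Longrightarrow> T (\<lambda>j. c j + d j) = (\<lambda>j. T c j + T d j)"
  by (simp add: linear_operator_def)

lemma linear_operator_scale:
  "linear_operator T \<Longrightarrow> T (\<lambda>j. r * c j) = (\<lambda>j. r * T c j)"
  by (simp add: linear_operator_def)

lemma linear_operator_funpow:
  assumes "linear_operator T"
  shows "linear_operator (T ^^ n)"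
  using assms by (induction n) (simp_all add: linear_operator_def)

lemma linear_operator_op_diff:
  assumes "linear_operator T" "linear_operator U"
  shows "linear_operator (op_diff T U)"
  using assms by (simp add: linear_operator_def op_diff_def algebra_simps)

lemma linear_operator_subdivision:
  assumes "finitely_supported a"
  shows "linear_operator (subdivision a)"
  unfolding linear_operator_def fun_eq_iff subdivision_eq_finite_sum(2)[OF assms]
  by (simp add: distrib_left sum.distrib sum_distrib_left mult.left_commute)

lemma abs_le_sup_norm: "ennreal \<bar>c j\<bar> \<le> sup_norm c"
  unfolding sup_norm_def by (rule SUP_upper) simp

lemma sup_norm_le: "(\<And>j. ennreal \<bar>c j\<bar> \<le> B) \<Longrightarrow> sup_norm c \<le> B"
  unfolding sup_norm_def by (rule SUP_least)

lemma sup_norm_le_op_norm: "sup_norm c \<le> 1 \<Longrightarrow> sup_norm (T c) \<le> op_norm T"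
  unfolding op_norm_def by (rule SUP_upper) simp

lemma op_norm_le: "(\<And>c. sup_norm c \<le> 1 \<Longrightarrow> sup_norm (T c) \<le> B) \<Longrightarrow> op_norm T \<le> B"
  unfolding op_norm_def by (rule SUP_least) simp

lemma sup_norm_scale: "sup_norm (\<lambda>j. r * c j) = ennreal \<bar>r\<bar> * sup_norm c"
  by (simp add: sup_norm_def abs_mult ennreal_mult SUP_mult_left_ennreal)

lemma sup_norm_add: "sup_norm (\<lambda>j. c j + d j) \<le> sup_norm c + sup_norm d"
proof (rule sup_norm_le)
  fix j
  have "ennreal \<bar>c j + d j\<bar> \<le> ennreal (\<bar>c j\<bar> + \<bar>d j\<bar>)"
    by (rule ennreal_leI) linarith
  also have "\<dots> \<le> sup_norm c + sup_norm d"
    by (simp add: abs_le_sup_norm add_mono)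
  finally show "ennreal \<bar>c j + d j\<bar> \<le> sup_norm c + sup_norm d" .
qed

text \<open>For \<open>c \<noteq> 0\<close> this is the definition of the operator norm after rescaling \<open>c\<close> to norm one. The
  finiteness assumption is essential: in \<open>ennreal\<close> the product \<open>0 * \<infinity>\<close> is \<open>0\<close>, and an
  operator that vanishes on bounded sequences may be nonzero on unbounded ones.\<close>

lemma sup_norm_apply_le:
  assumes T: "linear_operator T" and fin: "sup_norm c < \<infinity>"
  shows "sup_norm (T c) \<le> op_norm T * sup_norm c"
proof (cases "sup_norm c = 0")
  case True
  have "c j = 0" for j
    using abs_le_sup_norm[of c j] True by simp
  then have "c = (\<lambda>_. 0)"
    by (rule ext)
  then have "T c = (\<lambda>_. 0)"
    using linear_operator_scale[OF T, of 0 c] by simp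
  then have "sup_norm (T c) = 0"
    by (simp add: sup_norm_def)
  then show ?thesis
    by simp
next
  case False
  define r where "r = enn2real (sup_norm c)"
  have r: "sup_norm c = ennreal r" "r > 0"
    using False fin by (auto simp: r_def less_top enn2real_positive_iff zero_less_iff_neq_zero)
  let ?u = "\<lambda>j. inverse r * c j"
  have "sup_norm ?u \<le> 1"
    using r by (simp add: sup_norm_scale flip: ennreal_mult)
  then have "sup_norm (T ?u) \<le> op_norm T"
    by (rule sup_norm_le_op_norm)
  moreover have "T c = (\<lambda>j. r * T ?u j)"
    using r(2) by (simp add: linear_operator_scale[OF T] fun_eq_iff)
  then have "sup_norm (T c) = ennreal \<bar>r\<bar> * sup_norm (T ?u)"
    by (simp only: sup_norm_scale)
  ultimately have "sup_norm (T c) \<le> ennreal r * op_norm T"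
    using r(2) by (simp add: mult_left_mono)
  then show ?thesis
    by (simp add: r(1) mult.commute)
qed

lemma op_norm_comp_le:
  assumes "linear_operator T" and "op_norm U < \<infinity>"
  shows "op_norm (T \<circ> U) \<le> op_norm T * op_norm U"
proof (rule op_norm_le)
  fix c assume "sup_norm c \<le> 1"
  then have U: "sup_norm (U c) \<le> op_norm U"
    by (rule sup_norm_le_op_norm)
  then have "sup_norm (T (U c)) \<le> op_norm T * sup_norm (U c)"
    using assms by (intro sup_norm_apply_le) (auto intro: le_less_trans)
  also have "\<dots> \<le> op_norm T * op_norm U"
    using U by (rule mult_left_mono) simp
  finally show "sup_norm ((T \<circ> U) c) \<le> op_norm T * op_norm U"
    by simp
qed

lemma op_norm_add_le: "op_norm (\<lambda>c j. T c j + U c j) \<le> op_norm T + op_norm U"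
  by (rule op_norm_le, rule order_trans[OF sup_norm_add])
    (intro add_mono sup_norm_le_op_norm)

lemma op_norm_id: "op_norm id = 1"
proof (rule antisym)
  show "op_norm id \<le> 1"
    by (rule op_norm_le) simp
  have "sup_norm (\<lambda>_. 1) = 1"
    by (simp add: sup_norm_def)
  then show "1 \<le> op_norm id"
    using sup_norm_le_op_norm[of "\<lambda>_. 1" id] by simp
qed

lemma op_norm_power_le_power_bound: "op_norm (subdivision a ^^ n) \<le> power_bound a"
  unfolding power_bound_def by (rule SUP_upper) simp

lemma one_le_power_bound: "1 \<le> power_bound a"
  using op_norm_power_le_power_bound[where n = 0 and a = a]
  by (simp add: op_norm_id flip: id_def)

text \<open>The exponential bound must be claimed for all powers \<open>n\<close> at once: the step for \<open>n\<close> uses the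
  induction hypothesis for \<open>n + 1\<close>, and its case \<open>n = 0\<close> to bound the product itself. The product
  runs from \<open>m + 1\<close> to \<open>q\<close> and is empty for \<open>q = m\<close>.\<close>

lemma op_norm_power_subdivision_product_le:
  assumes A: "\<And>k. 1 \<le> k \<Longrightarrow> finitely_supported (A k)"
    and a: "finitely_supported a"
    and C: "power_bound a = ennreal C" "0 \<le> C"
    and d: "\<And>k. op_norm (op_diff (subdivision (A (Suc k))) (subdivision a)) = ennreal (d k)"
      "\<And>k. 0 \<le> d k"
    and "m \<le> q"
  shows "op_norm (subdivision a ^^ n \<circ> subdivision_product A q (Suc m))
    \<le> ennreal (C * exp (C * (\<Sum>k=m..<q. d k)))"
  using \<open>m \<le> q\<close>
proof (induction q arbitrary: n rule: dec_induct)
  case base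
  show ?case
    using op_norm_power_le_power_bound[where n = n and a = a] C
    by (simp add: subdivision_product_def)
next
  case (step q)
  define S where "S = subdivision a"
  define D where "D = op_diff (subdivision (A (Suc q))) S"
  define P where "P = subdivision_product A q (Suc m)"
  define B where "B = C * exp (C * (\<Sum>k=m..<q. d k))"
  have lin: "linear_operator (S ^^ n)" "linear_operator D"
    using A a by (simp_all add: S_def D_def linear_operator_funpow linear_operator_op_diff
        linear_operator_subdivision)
  have B: "0 \<le> B"
    using C by (simp add: B_def)
  have IH: "op_norm (S ^^ k \<circ> P) \<le> ennreal B" for k
    unfolding S_def P_def B_def by (rule step.IH)
  have P: "op_norm P \<le> ennreal B"
    using IH[of 0] by simp
  have "op_norm (D \<circ> P) \<le> op_norm D * op_norm P"
    using lin(2) P by (intro op_norm_comp_le) (auto intro: le_less_trans)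
  also have "\<dots> \<le> ennreal (d q) * ennreal B"
    using P d(1)[of q] by (simp add: D_def S_def mult_left_mono)
  finally have DP: "op_norm (D \<circ> P) \<le> ennreal (d q * B)"
    using d(2)[of q] B by (simp add: ennreal_mult)
  have "op_norm (S ^^ n \<circ> (D \<circ> P)) \<le> op_norm (S ^^ n) * op_norm (D \<circ> P)"
    using lin(1) DP by (intro op_norm_comp_le) (auto intro: le_less_trans)
  also have "\<dots> \<le> ennreal C * ennreal (d q * B)"
    using DP op_norm_power_le_power_bound[where n = n and a = a] C
    by (intro mult_mono) (auto simp: S_def)
  finally have SDP: "op_norm (S ^^ n \<circ> (D \<circ> P)) \<le> ennreal (C * (d q * B))"
    using C d(2)[of q] B by (simp add: ennreal_mult)
  have split: "S ^^ n \<circ> subdivision_product A (Suc q) (Suc m)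
      = (\<lambda>c j. (S ^^ Suc n \<circ> P) c j + (S ^^ n \<circ> (D \<circ> P)) c j)"
  proof
    fix c
    have "subdivision (A (Suc q)) (P c) = (\<lambda>j. S (P c) j + D (P c) j)"
      by (simp add: D_def op_diff_def)
    then show "(S ^^ n \<circ> subdivision_product A (Suc q) (Suc m)) c
        = (\<lambda>j. (S ^^ Suc n \<circ> P) c j + (S ^^ n \<circ> (D \<circ> P)) c j)"
      using step.hyps
      by (simp add: subdivision_product_Suc linear_operator_add[OF lin(1)] funpow_swap1
          flip: P_def)
  qed
  have "op_norm (S ^^ n \<circ> subdivision_product A (Suc q) (Suc m))
      \<le> op_norm (S ^^ Suc n \<circ> P) + op_norm (S ^^ n \<circ> (D \<circ> P))"
    unfolding split by (rule op_norm_add_le)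
  also have "\<dots> \<le> ennreal B + ennreal (C * (d q * B))"
    by (intro add_mono IH SDP)
  also have "\<dots> = ennreal (B * (1 + C * d q))"
    using B C d(2)[of q] by (simp add: algebra_simps flip: ennreal_plus)
  also have "\<dots> \<le> ennreal (B * exp (C * d q))"
    using B by (intro ennreal_leI mult_left_mono exp_ge_add_one_self)
  also have "B * exp (C * d q) = C * exp (C * (\<Sum>k=m..<Suc q. d k))"
    using step.hyps by (simp add: B_def algebra_simps flip: exp_add)
  finally show ?case
    by (simp add: S_def)
qed

theorem corollary3p6:
  fixes A :: "nat \<Rightarrow> int \<Rightarrow> real" and a :: "int \<Rightarrow> real"
  assumes "\<And>k. 1 \<le> k \<Longrightarrow> finitely_supported (A k)"
    and "finitely_supported a"
    and "power_bound a < \<infinity>"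
    and "total_deviation A a < \<infinity>"
  shows "(SUP J\<in>{1..}. product_bound A J) < \<infinity>
    \<and> (SUP J\<in>{1..}. product_bound A J)
        \<le> power_bound a * ennreal (exp (enn2real (power_bound a * total_deviation A a)))"
proof -
  define C where "C = enn2real (power_bound a)"
  define t where "t = enn2real (total_deviation A a)"
  define d where
    "d k = enn2real (op_norm (op_diff (subdivision (A (Suc k))) (subdivision a)))" for k
  have C: "power_bound a = ennreal C" "0 \<le> C"
    using assms(3) by (auto simp: C_def less_top)
  have C1: "1 \<le> C"
    using one_le_power_bound[of a] C by simp
  have t: "total_deviation A a = ennreal t" "0 \<le> t"
    using assms(4) by (auto simp: t_def less_top)
  have dev_sum: "(\<Sum>k\<in>K. op_norm (op_diff (subdivision (A (Suc k))) (subdivision a))) \<le> ennreal t"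
    if "finite K" for K
    using that by (simp add: t(1)[symmetric] total_deviation_def sum_le_suminf)
  have d: "op_norm (op_diff (subdivision (A (Suc k))) (subdivision a)) = ennreal (d k)"
    "0 \<le> d k" for k
    using le_less_trans[OF dev_sum[of "{k}"] ennreal_less_top] by (auto simp: d_def)
  have sum_d: "(\<Sum>k=m..<q. d k) \<le> t" for m q
    using dev_sum[of "{m..<q}"] t by (simp add: d sum_ennreal)
  have prod: "op_norm (subdivision_product A q p) \<le> ennreal (C * exp (C * t))"
    if "1 \<le> p" "p \<le> q" for p q
  proof -
    from that obtain m where m: "p = Suc m" "m \<le> q"
      by (cases p) auto
    have "op_norm (subdivision_product A q p) \<le> ennreal (C * exp (C * (\<Sum>k=m..<q. d k)))"
      using op_norm_power_subdivision_product_le[of A a C d m q 0] assms(1,2) C d m by simp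
    also have "\<dots> \<le> ennreal (C * exp (C * t))"
      using C sum_d by (intro ennreal_leI mult_left_mono) (auto intro: mult_left_mono)
    finally show ?thesis .
  qed
  have "product_bound A J \<le> ennreal (C * exp (C * t))" if "1 \<le> J" for J
  proof -
    let ?N = "{op_norm (subdivision_product A q p) | p q. 1 \<le> p \<and> p \<le> q \<and> q \<le> J}"
    have "?N \<subseteq> (\<lambda>(p, q). op_norm (subdivision_product A q p)) ` ({..J} \<times> {..J})"
      by force
    then have "finite ?N"
      by (rule finite_subset) simp
    moreover have "?N \<noteq> {}"
      using that by blast
    ultimately have "Max ?N \<le> ennreal (C * exp (C * t))"
      using prod by (subst Max_le_iff) auto
    moreover have "1 * 1 \<le> C * exp (C * t)"
      using C1 t(2) by (intro mult_mono) auto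
    ultimately show ?thesis
      by (simp add: product_bound_def)
  qed
  then have "(SUP J\<in>{1..}. product_bound A J) \<le> ennreal (C * exp (C * t))"
    by (intro SUP_least) simp
  moreover from this have "(SUP J\<in>{1..}. product_bound A J) < \<infinity>"
    by (rule le_less_trans) simp
  moreover have "ennreal (C * exp (C * t))
      = power_bound a * ennreal (exp (enn2real (power_bound a * total_deviation A a)))"
    using C t by (simp add: ennreal_mult enn2real_mult)
  ultimately show ?thesis
    by simp
qed

end
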